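(* Let $x\in(0,1)$ be irrational and suppose that the derivative $?'(x)$ exists and $?'(x)=0$. Then for any $\varepsilon>0$, for infinitely many positive integers $t$ one has $$\varphi^{(1)}_{x}(t)\ge (2\sqrt{2}-\varepsilon)\,\kappa_4\sqrt{t\log t}.$$
   Context: The Minkowski question-mark function $?:[0,1]\to[0,1]$ is the continuous strictly increasing function which at an irrational $x=[0;a_1,a_2,\ldots]$ (regular continued fraction with positive integer partial quotients) is given by $?(x)=\sum_{k=1}^{\infty}\frac{(-1)^{k+1}}{2^{a_1+\cdots+a_k-1}}$ (for rational $x$ the series is replaced by the corresponding finite sum). Its derivative at $x$ is denoted $?'(x)$. For irrational $x=[0;a_1,a_2,\ldots]$ put $S_x(t)=a_1+\cdots+a_t$ and $\varphi^{(1)}_x(t)=S_x(t)-\kappa_1 t$. Constants: $\kappa_1=\frac{2\log\Phi}{\log 2}$ with $\Phi=\frac{1+\sqrt5}{2}$, and $\kappa_4=\sqrt{\frac{\kappa_1-1}{\log 2}}$. Here $\log$ is the natural logarithm. *)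

theory Defs
  imports Complex_Main
begin

text \<open>
  Regular continued fraction expansion \<open>x = [0; a\<^sub>1, a\<^sub>2, \<dots>]\<close> of a real \<open>x\<close> in \<open>[0,1]\<close>,
  produced by the Gauss map: the remainders are \<open>x\<^sub>0 = x\<close> and \<open>x\<^sub>k\<^sub>+\<^sub>1 = {1/x\<^sub>k}\<close>, and the partial
  quotients are \<open>a\<^sub>k\<^sub>+\<^sub>1 = \<lfloor>1/x\<^sub>k\<rfloor>\<close>.  The expansion of a rational number stops at the first
  \<open>k\<close> with \<open>x\<^sub>k = 0\<close>; since \<open>1/0 = 0\<close>, all later remainders are then \<open>0\<close> as well.
\<close>

primrec cf_rem :: "real \<Rightarrow> nat \<Rightarrow> real" where
  "cf_rem x 0 = x"
| "cf_rem x (Suc k) = frac (1 / cf_rem x k)"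

text \<open>Partial quotients are indexed from 1; the value at index 0 is never used.\<close>

definition cf_quot :: "real \<Rightarrow> nat \<Rightarrow> nat" where
  "cf_quot x k = nat \<lfloor>1 / cf_rem x (k - 1)\<rfloor>"

definition cf_quot_sum :: "real \<Rightarrow> nat \<Rightarrow> nat" where
  "cf_quot_sum x t = (\<Sum>i=1..t. cf_quot x i)"

text \<open>
  The index is shifted by one, so the term at \<open>k\<close> belongs to \<open>a\<^sub>k\<^sub>+\<^sub>1\<close>.  For rational \<open>x\<close> the
  conditional cuts the series off after the last partial quotient.  The formula is meant for
  \<open>x\<close> in \<open>[0,1]\<close> only.
\<close>

definition minkowski_qm :: "real \<Rightarrow> real" where
  "minkowski_qm x =
     (\<Sum>k. if cf_rem x k = 0 then 0 else (-1) ^ k / 2 ^ (cf_quot_sum x (Suc k) - 1))"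

definition kappa1 :: real where
  "kappa1 = 2 * ln ((1 + sqrt 5) / 2) / ln 2"

definition kappa4 :: real where
  "kappa4 = sqrt ((kappa1 - 1) / ln 2)"

definition phi1 :: "real \<Rightarrow> nat \<Rightarrow> real" where
  "phi1 x t = real (cf_quot_sum x t) - kappa1 * real t"

lemma cf_rem_irrational:
  assumes "x \<in> {0<..<1}" "x \<notin> \<rat>"
  shows "cf_rem x k \<in> {0<..<1} \<and> cf_rem x k \<notin> \<rat>"
proof (induction k)
  case 0
  then show ?case using assms by simp
next
  case (Suc k)
  have "1 / cf_rem x k \<notin> \<rat>"
    using Suc Rats_inverse[of "1 / cf_rem x k"] by auto
  then have irr: "cf_rem x (Suc k) \<notin> \<rat>"
    using Rats_add[of "frac (1 / cf_rem x k)" "of_int \<lfloor>1 / cf_rem x k\<rfloor>"]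
    by (auto simp: frac_def)
  then have "cf_rem x (Suc k) \<noteq> 0" by (metis Rats_0)
  then show ?case
    using irr frac_ge_0[of "1 / cf_rem x k"] frac_lt_1[of "1 / cf_rem x k"] by auto
qed

lemma cf_quot_pos:
  assumes "x \<in> {0<..<1}" "x \<notin> \<rat>"
  shows "cf_quot x k \<ge> 1"
  using cf_rem_irrational[OF assms, of "k - 1"] by (simp add: cf_quot_def le_nat_iff)

lemma cf_rem_unfold:
  assumes "x \<in> {0<..<1}" "x \<notin> \<rat>"
  shows "cf_rem x k = 1 / (real (cf_quot x (Suc k)) + cf_rem x (Suc k))"
  using cf_rem_irrational[OF assms, of k] by (simp add: cf_quot_def frac_def)

lemma minkowski_qm_irrational:
  assumes "x \<in> {0<..<1}" "x \<notin> \<rat>"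
  shows "minkowski_qm x = (\<Sum>k. (-1) ^ k / 2 ^ (cf_quot_sum x (Suc k) - 1))"
proof -
  have "cf_rem x k \<noteq> 0" for k
    using cf_rem_irrational[OF assms, of k] by auto
  then show ?thesis by (simp add: minkowski_qm_def)
qed

lemma minkowski_qm_irrational_summable:
  assumes "x \<in> {0<..<1}" "x \<notin> \<rat>"
  shows "summable (\<lambda>k. (-1) ^ k / 2 ^ (cf_quot_sum x (Suc k) - 1) :: real)"
proof (rule summable_comparison_test')
  show "summable (\<lambda>k. (1 / 2 :: real) ^ k)" by (simp add: summable_geometric)
next
  fix k :: nat
  have "(\<Sum>i=1..Suc k. 1) \<le> cf_quot_sum x (Suc k)"
    unfolding cf_quot_sum_def by (intro sum_mono cf_quot_pos assms)
  then have "k \<le> cf_quot_sum x (Suc k) - 1" by simp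
  then have "(2::real) ^ k \<le> 2 ^ (cf_quot_sum x (Suc k) - 1)"
    by (rule power_increasing) simp
  then show "norm ((-1) ^ k / 2 ^ (cf_quot_sum x (Suc k) - 1) :: real) \<le> (1 / 2) ^ k"
    by (simp add: power_abs power_divide frac_le)
qed

end

theory Submission
  imports Defs "HOL-Real_Asymp.Real_Asymp" "HOL-Analysis.Convex"
begin

text \<open>
  Let \<open>q\<^sub>t\<close> be the denominator of the \<open>t\<close>-th convergent of \<open>x = [0; a\<^sub>1, a\<^sub>2, \<dots>]\<close>, and let
  \<open>S\<^sub>t = a\<^sub>1 + \<dots> + a\<^sub>t\<close>.  The points whose expansion starts with \<open>a\<^sub>1, \<dots>, a\<^sub>t\<close> form an interval
  of length comparable to \<open>1 / q\<^sub>t\<^sup>2\<close>, and the question-mark function maps this interval onto one of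
  length \<open>2\<close> to the power \<open>-S\<^sub>t\<close>.  A vanishing derivative therefore makes \<open>q\<^sub>t\<^sup>2\<close> at most a constant
  times \<open>2\<close> to the power \<open>S\<^sub>t\<close> (\<open>continuant_square_le_of_deriv_0\<close>).  In the other direction, a
  golden-ratio estimate gives, up to a constant factor,
  \<open>q\<^sub>t \<ge> \<Phi>\<^sup>t \<Prod>\<^sub>i (1 + (a\<^sub>i - 1) / \<Phi>\<^sup>2)\<close> (\<open>continuant_lower_bound\<close>).  After taking logarithms to base
  \<open>2\<close>, the two estimates combine to \<open>P(t) \<le> \<phi>(t) + C\<close>, where \<open>\<phi>(t) = S\<^sub>t - \<kappa>\<^sub>1 t\<close>,
  \<open>b\<^sub>i = a\<^sub>i - 1\<close>, and \<open>P(t)\<close> is the sum of \<open>h(b\<^sub>i) = 2 log\<^sub>2 (1 + b\<^sub>i / \<Phi>\<^sup>2)\<close> over \<open>i \<le> t\<close>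
  (\<open>excess_gain_sum_le_phi1\<close>).

  The rest is a statement about nonnegative sequences \<open>b\<close>.  Put \<open>R(t) = \<surd>(t ln t)\<close> and
  \<open>m = \<kappa>\<^sub>1 - 1\<close>, so that \<open>\<phi>(t)\<close> is the sum of \<open>b\<^sub>i - m\<close> over \<open>i \<le> t\<close>, and suppose that
  \<open>\<phi>(t) \<le> c R(t)\<close> for all large \<open>t\<close>.  If \<open>P(t) \<ge> p R(t)\<close> is known for large \<open>t\<close>, then at time \<open>t\<close>
  there is little room for a jump: \<open>b\<^sub>t\<close> is at most about \<open>(c - p) R(t)\<close>.  Since \<open>h\<close> is concave with
  \<open>h(0) = 0\<close>, splitting a given total into jumps of bounded size costs least when all of them have the
  maximal size; as \<open>\<phi>(t) \<ge> P(t) - C \<ge> - C\<close> makes the mean of the \<open>b\<^sub>i\<close> at least about \<open>m\<close>, the sum \<open>P(t)\<close> must grow at rate at least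
  \<open>m h((c - p) R(t)) / ((c - p) R(t))\<close>.  Integrating this, one gets \<open>P(t) \<ge> p' R(t)\<close> for every
  \<open>p' < 2 m / ((c - p) ln 2)\<close> (\<open>gain_bound_bootstrap\<close>).  If \<open>c\<^sup>2 < 8 m / ln 2\<close>, then
  \<open>p (c - p) \<le> c\<^sup>2 / 4 < 2 m / ln 2\<close>, so every such step raises \<open>p\<close> by a fixed amount, and \<open>p\<close> finally
  exceeds \<open>c\<close>, against \<open>P(t) \<le> c R(t) + C\<close>.  Hence \<open>c \<ge> 2\<surd>2 \<surd>(m / ln 2) = 2\<surd>2 \<kappa>\<^sub>4\<close>
  (\<open>drift_constant_lower_bound\<close>).
\<close>

section \<open>The question-mark function and the branches of the Gauss map\<close>

lemma one_div_add_irrational: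
  fixes \<theta> :: real
  assumes "\<theta> \<in> {0<..<1}" "\<theta> \<notin> \<rat>" "1 \<le> n"
  shows "1 / (real n + \<theta>) \<in> {0<..<1}" "1 / (real n + \<theta>) \<notin> \<rat>"
proof -
  show "1 / (real n + \<theta>) \<in> {0<..<1}" using assms by auto
  show "1 / (real n + \<theta>) \<notin> \<rat>"
  proof
    assume "1 / (real n + \<theta>) \<in> \<rat>"
    then have "inverse (1 / (real n + \<theta>)) - real n \<in> \<rat>"
      by (intro Rats_diff Rats_inverse) auto
    then show False using assms by simp
  qed
qed

lemma cf_rem_one_div_add:
  assumes "\<theta> \<in> {0<..<1}"
  shows "cf_rem (1 / (real n + \<theta>)) (Suc k) = cf_rem \<theta> k"
proof (induction k)
  case 0
  have "frac (real n + \<theta>) = \<theta>"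
    using assms frac_unique_iff[of "real n + \<theta>" \<theta>] by auto
  then show ?case by simp
next
  case (Suc k)
  then show ?case by simp
qed

lemma cf_quot_sum_one_div_add:
  assumes "\<theta> \<in> {0<..<1}"
  shows "cf_quot_sum (1 / (real n + \<theta>)) (Suc k) = n + cf_quot_sum \<theta> k"
proof -
  have "\<lfloor>real n + \<theta>\<rfloor> = int n"
    using assms by (simp add: floor_eq_iff)
  then have first: "cf_quot (1 / (real n + \<theta>)) 1 = n"
    by (simp add: cf_quot_def)
  have "cf_quot (1 / (real n + \<theta>)) (Suc i) = cf_quot \<theta> i" if "1 \<le> i" for i
    using cf_rem_one_div_add[OF assms, of n "i - 1"] that by (simp add: cf_quot_def)
  then have "(\<Sum>i=1..k. cf_quot (1 / (real n + \<theta>)) (Suc i)) = cf_quot_sum \<theta> k"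
    unfolding cf_quot_sum_def by (intro sum.cong) auto
  moreover have "cf_quot_sum (1 / (real n + \<theta>)) (Suc k) =
      cf_quot (1 / (real n + \<theta>)) 1 + (\<Sum>i=1..k. cf_quot (1 / (real n + \<theta>)) (Suc i))"
    unfolding cf_quot_sum_def by (simp add: sum.atLeast_Suc_atMost sum.shift_bounds_cl_Suc_ivl del: sum.cl_ivl_Suc)
  ultimately show ?thesis using first by simp
qed

lemma cf_quot_sum_pos:
  assumes "x \<in> {0<..<1}" "x \<notin> \<rat>"
  shows "1 \<le> cf_quot_sum x (Suc k)"
  using cf_quot_pos[OF assms, of "Suc k"] by (simp add: cf_quot_sum_def)

text \<open>
  Prepending a partial quotient \<open>n\<close> shifts the defining alternating series by one place and adds \<open>n\<close> to
  every exponent.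
\<close>

lemma minkowski_qm_one_div_add:
  assumes "\<theta> \<in> {0<..<1}" "\<theta> \<notin> \<rat>" "1 \<le> n"
  shows "minkowski_qm (1 / (real n + \<theta>)) = (2 - minkowski_qm \<theta>) / 2 ^ n"
proof -
  let ?y = "1 / (real n + \<theta>)"
  let ?f = "\<lambda>y k. (-1) ^ k / 2 ^ (cf_quot_sum y (Suc k) - 1) :: real"
  note y = one_div_add_irrational[OF assms]
  have head: "?f ?y 0 = 2 / 2 ^ n"
    using cf_quot_sum_one_div_add[OF assms(1), of n 0] assms(3)
    by (simp add: cf_quot_sum_def power_diff)
  have tail: "?f ?y (Suc k) = - (1 / 2 ^ n) * ?f \<theta> k" for k
  proof -
    have "cf_quot_sum ?y (Suc (Suc k)) - 1 = n + (cf_quot_sum \<theta> (Suc k) - 1)"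
      using cf_quot_sum_one_div_add[OF assms(1), of n "Suc k"] cf_quot_sum_pos[OF assms(1,2), of k]
      by simp
    then show ?thesis by (simp add: power_add)
  qed
  have "minkowski_qm ?y = (\<Sum>k. ?f ?y (Suc k)) + ?f ?y 0"
    unfolding minkowski_qm_irrational[OF y]
    using suminf_split_head[OF minkowski_qm_irrational_summable[OF y]] by simp
  also have "(\<Sum>k. ?f ?y (Suc k)) = - (1 / 2 ^ n) * (\<Sum>k. ?f \<theta> k)"
    unfolding tail by (rule suminf_mult[OF minkowski_qm_irrational_summable[OF assms(1,2)]])
  finally show ?thesis
    unfolding head minkowski_qm_irrational[OF assms(1,2)] by (simp add: field_simps)
qed

lemma minkowski_qm_unfold:
  assumes "x \<in> {0<..<1}" "x \<notin> \<rat>"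
  shows "minkowski_qm x = (2 - minkowski_qm (cf_rem x 1)) / 2 ^ cf_quot x 1"
  using minkowski_qm_one_div_add[of "cf_rem x 1" "cf_quot x 1"] cf_rem_unfold[OF assms, of 0]
    cf_rem_irrational[OF assms, of 1] cf_quot_pos[OF assms, of 1] by simp

text \<open>
  Comparison with a geometric series gives the crude upper bound \<open>2\<close>; two applications of the
  self-similarity then improve it, to the lower bound \<open>0\<close> and further to the upper bound \<open>1\<close>.
\<close>

lemma minkowski_qm_bounds:
  assumes "x \<in> {0<..<1}" "x \<notin> \<rat>"
  shows "minkowski_qm x \<in> {0..1}"
proof -
  have le2: "minkowski_qm y \<le> 2" if y: "y \<in> {0<..<1}" "y \<notin> \<rat>" for y
  proof -
    have "(-1) ^ k / 2 ^ (cf_quot_sum y (Suc k) - 1) \<le> (1 / 2 :: real) ^ k" for k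
    proof -
      have "(\<Sum>i=1..Suc k. 1) \<le> cf_quot_sum y (Suc k)"
        unfolding cf_quot_sum_def by (intro sum_mono cf_quot_pos y)
      then have "(2::real) ^ k \<le> 2 ^ (cf_quot_sum y (Suc k) - 1)"
        by (intro power_increasing) auto
      then have "1 / 2 ^ (cf_quot_sum y (Suc k) - 1) \<le> (1 / 2 :: real) ^ k"
        by (simp add: power_divide frac_le)
      moreover have "(-1) ^ k / 2 ^ (cf_quot_sum y (Suc k) - 1) \<le> 1 / (2 ^ (cf_quot_sum y (Suc k) - 1) :: real)"
        by (cases "even k") (simp_all add: divide_right_mono)
      ultimately show ?thesis by linarith
    qed
    then have "minkowski_qm y \<le> (\<Sum>k. (1 / 2 :: real) ^ k)"
      unfolding minkowski_qm_irrational[OF y]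
      by (intro suminf_le minkowski_qm_irrational_summable[OF y] summable_geometric) auto
    then show ?thesis by (simp add: suminf_geometric)
  qed
  have ge0: "0 \<le> minkowski_qm y" if y: "y \<in> {0<..<1}" "y \<notin> \<rat>" for y
    unfolding minkowski_qm_unfold[OF y]
    using le2[of "cf_rem y 1"] cf_rem_irrational[OF y, of 1] by simp
  have "(2::real) ^ 1 \<le> 2 ^ cf_quot x 1"
    using cf_quot_pos[OF assms] by (rule power_increasing) simp
  moreover have "0 \<le> minkowski_qm (cf_rem x 1)"
    using ge0 cf_rem_irrational[OF assms, of 1] by blast
  ultimately have "minkowski_qm x \<le> 1"
    unfolding minkowski_qm_unfold[OF assms] by (simp add: divide_simps)
  then show ?thesis using ge0[OF assms] by simp
qed

text \<open>
  Values at points above \<open>1/2\<close> are at least \<open>1/2\<close>, and values below \<open>1/2\<close> are at most \<open>1/2\<close>.  Prepending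
  \<open>3\<close> in the first case, and \<open>1\<close> in the second, to the expansion of \<open>x\<close> itself gives an irrational
  point whose value lies in the far quarter, at most \<open>1/4\<close> or at least \<open>3/4\<close>.
\<close>

lemma minkowski_qm_separated_point:
  assumes "x \<in> {0<..<1}" "x \<notin> \<rat>"
  obtains y where "y \<in> {0<..<1}" "y \<notin> \<rat>" "1 / 4 \<le> \<bar>minkowski_qm x - minkowski_qm y\<bar>"
proof (cases "cf_quot x 1 = 1")
  case True
  note b = minkowski_qm_bounds[OF assms] minkowski_qm_bounds[of "cf_rem x 1"]
    cf_rem_irrational[OF assms, of 1]
  have "1 / 2 \<le> minkowski_qm x"
    using b minkowski_qm_unfold[OF assms] True by simp
  moreover have "minkowski_qm (1 / (real 3 + x)) \<le> 1 / 4"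
    using b minkowski_qm_one_div_add[OF assms, of 3] by simp
  ultimately show ?thesis
    using one_div_add_irrational[OF assms, of 3] by (intro that[of "1 / (real 3 + x)"]) auto
next
  case False
  note b = minkowski_qm_bounds[OF assms] minkowski_qm_bounds[of "cf_rem x 1"]
    cf_rem_irrational[OF assms, of 1]
  have "2 \<le> cf_quot x 1" using cf_quot_pos[OF assms, of 1] False by linarith
  then have "(2::real) ^ 2 \<le> 2 ^ cf_quot x 1"
    by (rule power_increasing) simp
  then have "minkowski_qm x \<le> 1 / 2"
    unfolding minkowski_qm_unfold[OF assms] using b by (simp add: divide_simps)
  moreover have "minkowski_qm (1 / (real 1 + x)) = (2 - minkowski_qm x) / 2"
    using minkowski_qm_one_div_add[OF assms, of 1] by simp
  ultimately show ?thesis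
    using one_div_add_irrational[OF assms, of 1] by (intro that[of "1 / (real 1 + x)"]) auto
qed

section \<open>Cylinder intervals of the continued fraction expansion\<close>

text \<open>
  The index is shifted by one: \<open>continuant a (Suc t)\<close> is the denominator \<open>q\<^sub>t\<close> of the convergent
  \<open>[0; a\<^sub>1, \<dots>, a\<^sub>t]\<close>, and the value \<open>0\<close> at index \<open>0\<close> is the customary \<open>q\<close> with index \<open>-1\<close>.
\<close>

fun continuant :: "(nat \<Rightarrow> nat) \<Rightarrow> nat \<Rightarrow> real" where
  "continuant a 0 = 0"
| "continuant a (Suc 0) = 1"
| "continuant a (Suc (Suc t)) = real (a (Suc t)) * continuant a (Suc t) + continuant a t"

text \<open>
  The point \<open>[0; a\<^sub>1, \<dots>, a\<^sub>t + \<theta>]\<close>.  Recursion on the innermost quotient makes the denominators follow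
  the recurrence of \<open>continuant\<close>, with the tail \<open>\<theta>\<close> varying in inductions.
\<close>

primrec cf_cell :: "(nat \<Rightarrow> nat) \<Rightarrow> nat \<Rightarrow> real \<Rightarrow> real" where
  "cf_cell a 0 \<theta> = \<theta>"
| "cf_cell a (Suc t) \<theta> = cf_cell a t (1 / (real (a (Suc t)) + \<theta>))"

lemma cf_cell_cf_rem:
  assumes "x \<in> {0<..<1}" "x \<notin> \<rat>"
  shows "cf_cell (cf_quot x) t (cf_rem x t) = x"
  by (induction t) (simp_all add: cf_rem_unfold[OF assms, symmetric] del: cf_rem.simps(2))

lemma minkowski_qm_cf_cell_diff:
  assumes "\<theta> \<in> {0<..<1}" "\<theta> \<notin> \<rat>" "\<theta>' \<in> {0<..<1}" "\<theta>' \<notin> \<rat>" "\<forall>i. 1 \<le> a i"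
  shows "\<bar>minkowski_qm (cf_cell a t \<theta>) - minkowski_qm (cf_cell a t \<theta>')\<bar>
    = \<bar>minkowski_qm \<theta> - minkowski_qm \<theta>'\<bar> / 2 ^ (\<Sum>i=1..t. a i)"
  using assms(1-4)
proof (induction t arbitrary: \<theta> \<theta>')
  case 0
  then show ?case by simp
next
  case (Suc t)
  let ?n = "a (Suc t)"
  have "\<bar>minkowski_qm (1 / (real ?n + \<theta>)) - minkowski_qm (1 / (real ?n + \<theta>'))\<bar>
      = \<bar>(minkowski_qm \<theta>' - minkowski_qm \<theta>) / 2 ^ ?n\<bar>"
    unfolding minkowski_qm_one_div_add[OF Suc.prems(1,2) spec[OF assms(5)]]
      minkowski_qm_one_div_add[OF Suc.prems(3,4) spec[OF assms(5)]]
    by (simp add: diff_divide_distrib[symmetric])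
  also have "\<dots> = \<bar>minkowski_qm \<theta> - minkowski_qm \<theta>'\<bar> / 2 ^ ?n"
    by (simp add: abs_minus_commute)
  finally show ?case
    using Suc.IH[of "1 / (real ?n + \<theta>)" "1 / (real ?n + \<theta>')"] Suc.prems
      one_div_add_irrational[OF _ _ spec[OF assms(5)]]
    by (simp add: power_add)
qed

lemma continuant_nonneg: "0 \<le> continuant a t"
  by (induction a t rule: continuant.induct) simp_all

lemma continuant_mono:
  assumes "\<forall>i. 1 \<le> a i"
  shows "continuant a t \<le> continuant a (Suc t)"
proof (cases t)
  case (Suc s)
  have "1 * continuant a t \<le> real (a t) * continuant a t"
    using assms continuant_nonneg by (intro mult_right_mono) simp_all
  then show ?thesis using Suc continuant_nonneg[of a s] by simp
qed simp

lemma continuant_ge_1: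
  assumes "\<forall>i. 1 \<le> a i"
  shows "1 \<le> continuant a (Suc t)"
proof (induction t)
  case (Suc t)
  then show ?case using continuant_mono[OF assms, of "Suc t"] by linarith
qed simp

text \<open>
  The point is the image of \<open>\<theta>\<close> under the Moebius map \<open>(p\<^sub>t + \<theta> p') / (q\<^sub>t + \<theta> q')\<close> of
  determinant \<open>\<plusminus>1\<close>, where \<open>p'\<close> and \<open>q'\<close> belong to the preceding convergent; numerators cancel from differences.
\<close>

lemma cf_cell_diff:
  assumes "\<forall>i. 1 \<le> a i" "0 < \<theta>" "0 < \<theta>'"
  shows "\<bar>cf_cell a t \<theta> - cf_cell a t \<theta>'\<bar> = \<bar>\<theta> - \<theta>'\<bar> /
    ((continuant a (Suc t) + \<theta> * continuant a t) * (continuant a (Suc t) + \<theta>' * continuant a t))"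
  using assms(2,3)
proof (induction t arbitrary: \<theta> \<theta>')
  case 0
  then show ?case by simp
next
  case (Suc t)
  define n q p where "n = real (a (Suc t))" and "q = continuant a (Suc t)" and "p = continuant a t"
  have n: "0 < n" using spec[OF assms(1), of "Suc t"] by (simp add: n_def)
  have q: "0 < q" using continuant_ge_1[OF assms(1), of t] by (simp add: q_def)
  have pos: "0 < n + \<theta>" "0 < n + \<theta>'" using n Suc.prems by simp_all
  have num: "\<bar>1 / (n + \<theta>) - 1 / (n + \<theta>')\<bar> = \<bar>\<theta> - \<theta>'\<bar> / ((n + \<theta>) * (n + \<theta>'))"
  proof -
    have "1 / (n + \<theta>) - 1 / (n + \<theta>') = (\<theta>' - \<theta>) / ((n + \<theta>) * (n + \<theta>'))"
      using pos by (simp add: diff_frac_eq)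
    then show ?thesis using pos by (simp add: abs_mult abs_minus_commute)
  qed
  have den: "q + 1 / (n + \<psi>) * p = (n * q + p + \<psi> * q) / (n + \<psi>)" if "0 < n + \<psi>" for \<psi>
    using that by (simp add: field_simps)
  have "\<bar>cf_cell a (Suc t) \<theta> - cf_cell a (Suc t) \<theta>'\<bar>
      = \<bar>1 / (n + \<theta>) - 1 / (n + \<theta>')\<bar> / ((q + 1 / (n + \<theta>) * p) * (q + 1 / (n + \<theta>') * p))"
    using Suc.IH[of "1 / (n + \<theta>)" "1 / (n + \<theta>')"] pos by (simp add: n_def q_def p_def)
  also have "\<dots> = \<bar>\<theta> - \<theta>'\<bar> / ((n * q + p + \<theta> * q) * (n * q + p + \<theta>' * q))"
    unfolding num den[OF pos(1)] den[OF pos(2)] using pos by simp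
  finally show ?case by (simp add: n_def q_def p_def)
qed

lemma cf_cell_dist_le:
  assumes "\<forall>i. 1 \<le> a i" "\<theta> \<in> {0<..<1}" "\<theta>' \<in> {0<..<1}"
  shows "\<bar>cf_cell a t \<theta> - cf_cell a t \<theta>'\<bar> \<le> 1 / (continuant a (Suc t))\<^sup>2"
proof -
  let ?q = "continuant a (Suc t)"
  have q: "1 \<le> ?q" by (rule continuant_ge_1[OF assms(1)])
  have "?q * ?q \<le> (?q + \<theta> * continuant a t) * (?q + \<theta>' * continuant a t)"
    using q assms(2,3) continuant_nonneg[of a t] by (intro mult_mono) auto
  moreover have "0 < \<theta>" "0 < \<theta>'" using assms(2,3) by auto
  ultimately show ?thesis
    unfolding cf_cell_diff[OF assms(1) \<open>0 < \<theta>\<close> \<open>0 < \<theta>'\<close>] power2_eq_square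
    using q assms(2,3) by (intro frac_le) auto
qed

section \<open>Growth of the denominators\<close>

definition golden :: real where
  "golden = (1 + sqrt 5) / 2"

lemma golden_square: "golden * golden = golden + 1"
  by (simp add: golden_def field_simps)

lemma golden_gt_1: "1 < golden"
proof -
  have "sqrt 1 < sqrt 5" by (subst real_sqrt_less_iff) simp
  then show ?thesis by (simp add: golden_def)
qed

text \<open>
  The functional \<open>\<Phi> q\<^sub>t + q'\<close>, where \<open>q'\<close> is the preceding denominator, is the left eigenvector of
  the matrix of a step with \<open>a = 1\<close>: such a step multiplies it by exactly \<open>\<Phi>\<close>.  A larger quotient
  adds \<open>\<Phi> (a - 1) q\<^sub>t\<close>, and \<open>q\<^sub>t\<close> is at least the fraction \<open>1 / (\<Phi> + 1) = 1 / \<Phi>\<^sup>2\<close> of the functional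
  because \<open>q' \<le> q\<^sub>t\<close>.
\<close>

lemma continuant_lower_bound:
  assumes "\<forall>i. 1 \<le> a i"
  shows "golden ^ Suc t * (\<Prod>i=1..t. 1 + (real (a i) - 1) / golden\<^sup>2)
    \<le> golden * continuant a (Suc t) + continuant a t"
proof (induction t)
  case 0
  then show ?case by simp
next
  case (Suc t)
  define n q p where "n = real (a (Suc t)) - 1" and "q = continuant a (Suc t)" and "p = continuant a t"
  have n: "0 \<le> n" using spec[OF assms, of "Suc t"] by (simp add: n_def)
  have pq: "p \<le> q" unfolding p_def q_def by (rule continuant_mono[OF assms])
  have g: "0 < golden" "golden\<^sup>2 = golden + 1"
    using golden_gt_1 golden_square by (simp_all add: power2_eq_square)
  have "golden * q + p \<le> golden\<^sup>2 * q"
    using pq unfolding g(2) by (simp add: algebra_simps)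
  then have "(golden * q + p) / golden\<^sup>2 \<le> q"
    using g by (simp add: pos_divide_le_eq mult.commute)
  then have "golden * n * ((golden * q + p) / golden\<^sup>2) \<le> golden * n * q"
    using n g by (intro mult_left_mono) auto
  then have "golden * (1 + n / golden\<^sup>2) * (golden * q + p) \<le> golden * (golden * q + p) + golden * n * q"
    by (simp add: algebra_simps)
  also have "golden * (golden * q + p) = (golden + 1) * q + golden * p"
    by (simp add: algebra_simps golden_square flip: mult.assoc)
  also have "(golden + 1) * q + golden * p + golden * n * q = golden * ((n + 1) * q + p) + q"
    by (simp add: algebra_simps)
  finally have step: "golden * (1 + n / golden\<^sup>2) * (golden * q + p) \<le> golden * ((n + 1) * q + p) + q" .
  have "golden ^ Suc (Suc t) * (\<Prod>i=1..Suc t. 1 + (real (a i) - 1) / golden\<^sup>2)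
      = golden * (1 + n / golden\<^sup>2) * (golden ^ Suc t * (\<Prod>i=1..t. 1 + (real (a i) - 1) / golden\<^sup>2))"
    by (simp add: n_def)
  also have "\<dots> \<le> golden * (1 + n / golden\<^sup>2) * (golden * q + p)"
    using Suc.IH n g by (intro mult_left_mono) (auto simp: q_def p_def)
  also note step
  finally show ?case by (simp add: n_def q_def p_def)
qed

lemma continuant_ge_golden_power:
  assumes "\<forall>i. 1 \<le> a i"
  shows "golden ^ t * (\<Prod>i=1..t. 1 + (real (a i) - 1) / golden\<^sup>2) \<le> golden * continuant a (Suc t)"
proof -
  have "golden * (golden ^ t * (\<Prod>i=1..t. 1 + (real (a i) - 1) / golden\<^sup>2))
      \<le> golden * continuant a (Suc t) + continuant a t"
    using continuant_lower_bound[OF assms, of t] by (simp add: mult.assoc)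
  also have "\<dots> \<le> (golden + 1) * continuant a (Suc t)"
    using continuant_mono[OF assms, of t] by (simp add: algebra_simps)
  also have "\<dots> = golden * (golden * continuant a (Suc t))"
    by (simp add: golden_square flip: mult.assoc)
  finally show ?thesis using golden_gt_1 by simp
qed

lemma continuant_at_top:
  assumes "\<forall>i. 1 \<le> a i"
  shows "filterlim (\<lambda>t. continuant a (Suc t)) at_top sequentially"
proof (rule filterlim_at_top_mono)
  show "filterlim (\<lambda>t. golden ^ t / golden) at_top sequentially"
    using golden_gt_1 by real_asymp
  show "eventually (\<lambda>t. golden ^ t / golden \<le> continuant a (Suc t)) sequentially"
  proof (rule always_eventually, rule allI)
    fix t
    have "1 \<le> (\<Prod>i=1..t. 1 + (real (a i) - 1) / golden\<^sup>2)"
      using assms by (intro prod_ge_1) simp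
    then have "golden ^ t * 1 \<le> golden ^ t * (\<Prod>i=1..t. 1 + (real (a i) - 1) / golden\<^sup>2)"
      using golden_gt_1 by (intro mult_left_mono) auto
    also note continuant_ge_golden_power[OF assms, of t]
    finally show "golden ^ t / golden \<le> continuant a (Suc t)"
      using golden_gt_1 by (simp add: pos_divide_le_eq mult.commute)
  qed
qed

section \<open>Consequence of a vanishing derivative\<close>

text \<open>
  At every level \<open>t\<close> the cylinder around \<open>x\<close> contains a point whose value differs from that of \<open>x\<close> by
  at least a quarter of the length of the image of the cylinder.  The corresponding difference quotients are at
  least a quarter of \<open>q\<^sub>t\<^sup>2\<close> divided by \<open>2\<close> to the power \<open>S\<^sub>t\<close>, and they are eventually below \<open>1\<close>.
\<close>

lemma continuant_square_le_of_deriv_0: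
  assumes "x \<in> {0<..<1}" "x \<notin> \<rat>" and "(minkowski_qm has_real_derivative 0) (at x)"
  shows "eventually (\<lambda>t. (continuant (cf_quot x) (Suc t))\<^sup>2 \<le> 4 * 2 ^ cf_quot_sum x t) sequentially"
proof -
  have a: "\<forall>i. 1 \<le> cf_quot x i" using cf_quot_pos[OF assms(1,2)] by blast
  have "eventually (\<lambda>y. \<bar>(minkowski_qm y - minkowski_qm x) / (y - x)\<bar> < 1) (at x)"
    using tendstoD[OF assms(3)[unfolded has_field_derivative_iff], of 1] by simp
  then obtain d where d: "0 < d"
    "\<And>y. y \<noteq> x \<Longrightarrow> \<bar>y - x\<bar> < d \<Longrightarrow> \<bar>(minkowski_qm y - minkowski_qm x) / (y - x)\<bar> < 1"
    unfolding eventually_at dist_real_def by blast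
  have "filterlim (\<lambda>t. (continuant (cf_quot x) (Suc t))\<^sup>2) at_top sequentially"
    by (intro filterlim_pow_at_top continuant_at_top a) simp
  then have "eventually (\<lambda>t. 1 / d < (continuant (cf_quot x) (Suc t))\<^sup>2) sequentially"
    by (simp add: filterlim_at_top_dense)
  then show ?thesis
  proof eventually_elim
    case (elim t)
    let ?q = "continuant (cf_quot x) (Suc t)"
    obtain \<theta> where \<theta>: "\<theta> \<in> {0<..<1}" "\<theta> \<notin> \<rat>"
      "1 / 4 \<le> \<bar>minkowski_qm (cf_rem x t) - minkowski_qm \<theta>\<bar>"
      using minkowski_qm_separated_point cf_rem_irrational[OF assms(1,2), of t] by metis
    define y where "y = cf_cell (cf_quot x) t \<theta>"
    have "\<bar>x - y\<bar> \<le> 1 / ?q\<^sup>2"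
      using cf_cell_dist_le[OF a, of "cf_rem x t" \<theta> t] \<theta>(1) cf_rem_irrational[OF assms(1,2), of t]
      by (simp add: cf_cell_cf_rem[OF assms(1,2)] y_def)
    moreover have q: "0 < ?q\<^sup>2"
      using continuant_ge_1[OF a, of t] by (intro zero_less_power) linarith
    moreover have "1 / ?q\<^sup>2 < d"
      using elim q d(1) by (simp add: field_simps)
    ultimately have near: "\<bar>y - x\<bar> \<le> 1 / ?q\<^sup>2" "\<bar>y - x\<bar> < d" by linarith+
    have "\<bar>minkowski_qm x - minkowski_qm y\<bar> =
        \<bar>minkowski_qm (cf_rem x t) - minkowski_qm \<theta>\<bar> / 2 ^ cf_quot_sum x t"
      using minkowski_qm_cf_cell_diff[of "cf_rem x t" \<theta> "cf_quot x" t] \<theta>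
        cf_rem_irrational[OF assms(1,2), of t] a
      by (simp add: cf_cell_cf_rem[OF assms(1,2)] y_def cf_quot_sum_def)
    moreover have "(1 / 4) / 2 ^ cf_quot_sum x t \<le>
        \<bar>minkowski_qm (cf_rem x t) - minkowski_qm \<theta>\<bar> / 2 ^ cf_quot_sum x t"
      using \<theta>(3) by (intro divide_right_mono) auto
    ultimately have far: "1 / (4 * 2 ^ cf_quot_sum x t) \<le> \<bar>minkowski_qm y - minkowski_qm x\<bar>"
      by (simp add: abs_minus_commute)
    have "y \<noteq> x"
    proof
      assume "y = x"
      with far have "1 / (4 * 2 ^ cf_quot_sum x t) \<le> (0::real)" by simp
      moreover have "0 < 1 / (4 * 2 ^ cf_quot_sum x t :: real)" by simp
      ultimately show False by linarith
    qed
    then have "\<bar>minkowski_qm y - minkowski_qm x\<bar> < \<bar>y - x\<bar>"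
      using d(2)[OF _ near(2)] by (simp add: pos_divide_less_eq)
    with near far have "1 / (4 * 2 ^ cf_quot_sum x t) \<le> 1 / ?q\<^sup>2" by linarith
    then show ?case using q by (simp add: field_simps)
  qed
qed

lemma kappa1_eq: "kappa1 = 2 * log 2 golden"
  by (simp add: kappa1_def golden_def log_def)

lemma kappa1_gt_1: "1 < kappa1"
proof -
  have "log 2 2 < log 2 (golden\<^sup>2)"
    using golden_gt_1 golden_square by (subst log_less_cancel_iff) (auto simp: power2_eq_square)
  then show ?thesis using golden_gt_1 by (simp add: kappa1_eq log_nat_power)
qed

text \<open>
  Twice the binary logarithm of the factor by which a quotient \<open>1 + y\<close>, compared with a quotient \<open>1\<close>,
  is sure to enlarge the denominators, when \<open>r = 1 / \<Phi>\<^sup>2\<close>.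
\<close>

definition excess_gain :: "real \<Rightarrow> real \<Rightarrow> real" where
  "excess_gain r y = 2 * log 2 (1 + r * y)"

lemma excess_gain_sum_le_phi1:
  assumes "x \<in> {0<..<1}" "x \<notin> \<rat>"
    and "(continuant (cf_quot x) (Suc t))\<^sup>2 \<le> 4 * 2 ^ cf_quot_sum x t"
  shows "(\<Sum>i=1..t. excess_gain (1 / golden\<^sup>2) (real (cf_quot x i) - 1)) \<le> phi1 x t + (kappa1 + 2)"
proof -
  have a: "\<forall>i. 1 \<le> cf_quot x i" using cf_quot_pos[OF assms(1,2)] by blast
  define G where "G i = 1 + (real (cf_quot x i) - 1) / golden\<^sup>2" for i
  have G: "1 \<le> G i" for i
    using spec[OF a, of i] by (simp add: G_def)
  have g: "0 < golden" using golden_gt_1 by simp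
  have G_nz: "G i \<noteq> 0" for i
    using G[of i] by linarith
  have Gprod: "0 < prod G {1..t}"
    using G by (intro prod_pos) (metis less_le_trans zero_less_one)
  have "(golden ^ t * prod G {1..t})\<^sup>2 \<le> (golden * continuant (cf_quot x) (Suc t))\<^sup>2"
    using continuant_ge_golden_power[OF a, of t] Gprod g
    by (intro power_mono) (auto simp: G_def)
  also have "\<dots> \<le> golden\<^sup>2 * (4 * 2 ^ cf_quot_sum x t)"
    unfolding power_mult_distrib using assms(3) by (intro mult_left_mono) auto
  finally have "log 2 ((golden ^ t * prod G {1..t})\<^sup>2) \<le> log 2 (golden\<^sup>2 * (4 * 2 ^ cf_quot_sum x t))"
    by (intro log_mono zero_less_power[OF mult_pos_pos[OF zero_less_power[OF g] Gprod]]) simp_all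
  moreover have "log 2 ((golden ^ t * Q)\<^sup>2) = kappa1 * real t + 2 * log 2 Q" if "0 < Q" for Q
    using that g by (simp add: log_nat_power log_mult kappa1_eq algebra_simps)
  note this[OF Gprod]
  moreover have "log 2 (prod G {1..t}) = (\<Sum>i=1..t. log 2 (G i))"
    unfolding log_def ln_prod[OF finite_atLeastAtMost G_nz] by (rule sum_divide_distrib)
  moreover have "log 2 (golden\<^sup>2 * (4 * 2 ^ cf_quot_sum x t)) = kappa1 + (2 + real (cf_quot_sum x t))"
  proof -
    have "log 2 (4 * 2 ^ cf_quot_sum x t) = log 2 (2 ^ (2 + cf_quot_sum x t))"
      by (simp only: power_add) simp
    also have "\<dots> = 2 + real (cf_quot_sum x t)"
      by (subst log_nat_power) simp_all
    finally show ?thesis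
      using g log_nat_power[of golden 2 2] by (subst log_mult) (simp_all add: kappa1_eq)
  qed
  moreover have "(\<Sum>i=1..t. excess_gain (1 / golden\<^sup>2) (real (cf_quot x i) - 1)) = 2 * (\<Sum>i=1..t. log 2 (G i))"
    by (simp add: excess_gain_def G_def sum_distrib_left)
  ultimately show ?thesis
    unfolding phi1_def by linarith
qed

section \<open>Sequences with small drift\<close>

definition sqrt_log_scale :: "real \<Rightarrow> real" where
  "sqrt_log_scale x = sqrt (x * ln x)"

lemma excess_gain_nonneg:
  assumes "0 \<le> r" "0 \<le> y"
  shows "0 \<le> excess_gain r y"
  using assms by (simp add: excess_gain_def add_pos_nonneg)

text \<open>
  By concavity, the slope of the chord from the origin decreases: a jump \<open>x\<close> bounded by \<open>y\<close> gains at
  least the amount per unit that the jump \<open>y\<close> gains.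
\<close>

lemma excess_gain_slope_antimono:
  assumes "0 < r" "0 \<le> x" "x \<le> y" "0 < y"
  shows "x * (excess_gain r y / y) \<le> excess_gain r x"
proof -
  have "(1 - x / y) * log 2 1 + x / y * log 2 (1 + r * y)
      \<le> log 2 ((1 - x / y) *\<^sub>R 1 + (x / y) *\<^sub>R (1 + r * y))"
    using assms by (intro concave_onD[OF log_concave]) (auto intro: add_pos_nonneg)
  also have "(1 - x / y) *\<^sub>R 1 + (x / y) *\<^sub>R (1 + r * y) = 1 + r * x"
    using assms by (simp add: field_simps)
  finally have "2 * (x / y * log 2 (1 + r * y)) \<le> 2 * log 2 (1 + r * x)"
    by simp
  then show ?thesis
    by (simp add: excess_gain_def mult.left_commute)
qed

lemma sqrt_log_scale_ratio:
  "(\<lambda>t. sqrt_log_scale (real t) / sqrt_log_scale (real (Suc t))) \<longlonglongrightarrow> 1"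
proof -
  have "((\<lambda>x::real. sqrt_log_scale (x - 1) / sqrt_log_scale x) \<longlongrightarrow> 1) at_top"
    unfolding sqrt_log_scale_def by real_asymp
  from filterlim_compose[OF this filterlim_compose[OF filterlim_real_sequentially filterlim_Suc]]
  show ?thesis by simp
qed

lemma sqrt_log_scale_at_top: "filterlim (\<lambda>t. sqrt_log_scale (real t)) at_top sequentially"
  unfolding sqrt_log_scale_def by real_asymp

lemma sqrt_log_scale_mono:
  assumes "1 \<le> x" "x \<le> y"
  shows "sqrt_log_scale x \<le> sqrt_log_scale y"
  unfolding sqrt_log_scale_def using assms by (intro real_sqrt_le_mono mult_mono) auto

text \<open>
  Since \<open>log\<^sub>2 (R(t)) \<sim> log\<^sub>2 t / 2\<close>, the gain per unit for jumps of size \<open>\<beta> R(t)\<close> is asymptotic to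
  \<open>\<surd>(ln t / t) / (\<beta> ln 2)\<close>, while the increments of \<open>R\<close> are asymptotic to \<open>\<surd>(ln t / t) / 2\<close>.
\<close>

lemma excess_gain_slope_asymp:
  assumes "0 < r" "0 < \<beta>"
  shows "(\<lambda>t. excess_gain r (\<beta> * sqrt_log_scale (real (Suc t))) / (\<beta> * sqrt_log_scale (real (Suc t))) /
           (sqrt_log_scale (real (Suc t)) - sqrt_log_scale (real t)))
         \<longlonglongrightarrow> 2 / (\<beta> * ln 2)"
proof -
  have "((\<lambda>x::real. excess_gain r (\<beta> * sqrt_log_scale x) / (\<beta> * sqrt_log_scale x) /
           (sqrt_log_scale x - sqrt_log_scale (x - 1))) \<longlongrightarrow> inverse (ln 2) * inverse \<beta> * 2) at_top"
    unfolding sqrt_log_scale_def excess_gain_def using assms by real_asymp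
  from filterlim_compose[OF this filterlim_compose[OF filterlim_real_sequentially filterlim_Suc]]
  show ?thesis by (simp add: field_simps)
qed

text \<open>
  The lower bound for \<open>P\<close> limits the jumps to \<open>b\<^sub>t \<le> \<beta> R(t)\<close>, so that they gain at least
  \<open>w(t) = h(\<beta> R(t)) / (\<beta> R(t))\<close> per unit.  Instead of summing by parts, the proof shows that the potential
  \<open>V = P - m s R - (D + C) w\<close> is eventually nondecreasing, where \<open>s\<close> lies between \<open>p' / m\<close> and
  the limit of the quotient of \<open>w\<close> and the increments of \<open>R\<close>.  A step of \<open>V\<close> is a sum of three nonnegative terms: the
  gain beyond \<open>b w\<close>, the surplus of \<open>m w\<close> over the step of \<open>m s R\<close>, and the decrease of \<open>w\<close> weighted
  by \<open>D + C \<ge> P \<ge> 0\<close>.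
\<close>

lemma gain_bound_bootstrap:
  fixes b :: "nat \<Rightarrow> real" and r m :: real
  defines "P \<equiv> \<lambda>t. \<Sum>i=1..t. excess_gain r (b i)"
  defines "D \<equiv> \<lambda>t. \<Sum>i=1..t. b i - m"
  defines "R \<equiv> \<lambda>t::nat. sqrt_log_scale (real t)"
  assumes r: "0 < r" and m: "0 < m" and b: "\<And>i. 0 \<le> b i"
    and drift: "eventually (\<lambda>t. D t \<le> c * R t) sequentially"
    and gain: "eventually (\<lambda>t. P t \<le> D t + C) sequentially"
    and low: "eventually (\<lambda>t. p * R t \<le> P t) sequentially"
    and \<beta>: "0 < \<beta>" "c - p < \<beta>" and p': "p' * \<beta> < 2 * m / ln 2"
  shows "eventually (\<lambda>t. p' * R t \<le> P t) sequentially"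
proof -
  define w where "w t = excess_gain r (\<beta> * R t) / (\<beta> * R t)" for t
  have "p' / m < 2 / (\<beta> * ln 2)"
    using m \<beta>(1) p' by (simp add: field_simps)
  then obtain s where s: "p' / m < s" "s < 2 / (\<beta> * ln 2)"
    using dense by blast
  define V where "V t = P t - m * s * R t - (D t + C) * w t" for t
  have P_nonneg: "0 \<le> P t" for t
    unfolding P_def using r b by (intro sum_nonneg excess_gain_nonneg) auto
  have R_large: "eventually (\<lambda>t. K \<le> R t) sequentially" for K
    using sqrt_log_scale_at_top unfolding R_def filterlim_at_top by blast
  have R_mono: "R t \<le> R (Suc t)" if "1 \<le> t" for t
    unfolding R_def using that by (intro sqrt_log_scale_mono) auto
  \<comment> \<open>The bound on the jump at \<open>Suc t\<close>, divided by \<open>R (Suc t)\<close>, tends to \<open>c - p\<close>.\<close>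
  have lim_excess: "(\<lambda>t. c - p * (R t / R (Suc t)) + (C + m) / R (Suc t)) \<longlonglongrightarrow> c - p * 1 + 0"
    unfolding R_def
    by (intro tendsto_intros sqrt_log_scale_ratio tendsto_divide_0[OF tendsto_const]
          filterlim_at_top_imp_at_infinity
          filterlim_compose[OF sqrt_log_scale_at_top filterlim_Suc])
  have "eventually (\<lambda>t. c - p * (R t / R (Suc t)) + (C + m) / R (Suc t) < \<beta>) sequentially"
    using order_tendstoD(2)[OF lim_excess, of \<beta>] \<beta> by simp
  moreover have "eventually (\<lambda>t. s < w (Suc t) / (R (Suc t) - R t)) sequentially"
    using order_tendstoD(1)[OF excess_gain_slope_asymp[OF r \<beta>(1)] s(2)]
    unfolding w_def R_def .
  moreover have "eventually (\<lambda>t. D (Suc t) \<le> c * R (Suc t)) sequentially"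
    using drift by (rule eventually_compose_filterlim) (rule filterlim_Suc)
  ultimately have "eventually (\<lambda>t. V t \<le> V (Suc t)) sequentially"
    using gain low R_large[of 1] eventually_ge_at_top[of 1]
  proof eventually_elim
    case (elim t)
    note Rm = R_mono[OF elim(7)]
    have R_pos: "0 < R t" "0 < R (Suc t)" using elim(6) Rm by linarith+
    have D_step: "D (Suc t) = D t + (b (Suc t) - m)"
      by (simp add: D_def)
    have P_step: "P (Suc t) = P t + excess_gain r (b (Suc t))"
      by (simp add: P_def)
    have "b (Suc t) \<le> c * R (Suc t) - p * R t + (C + m)"
      using D_step elim(3,4,5) by linarith
    also have "\<dots> = (c - p * (R t / R (Suc t)) + (C + m) / R (Suc t)) * R (Suc t)"
      using R_pos by (simp add: field_simps)
    also have "\<dots> \<le> \<beta> * R (Suc t)"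
      using elim(1) R_pos by (intro mult_right_mono) auto
    finally have b_le: "b (Suc t) \<le> \<beta> * R (Suc t)" .
    have g: "b (Suc t) * w (Suc t) \<le> excess_gain r (b (Suc t))"
      unfolding w_def using r \<beta> b b_le R_pos
      by (intro excess_gain_slope_antimono) auto
    have w_nonneg: "0 \<le> w (Suc t)"
      unfolding w_def using r \<beta> R_pos
      by (intro divide_nonneg_nonneg excess_gain_nonneg) auto
    have "\<beta> * R t * (excess_gain r (\<beta> * R (Suc t)) / (\<beta> * R (Suc t))) \<le> excess_gain r (\<beta> * R t)"
      using r \<beta> R_pos Rm by (intro excess_gain_slope_antimono) auto
    then have w_anti: "w (Suc t) \<le> w t"
      unfolding w_def using \<beta> R_pos by (simp add: pos_le_divide_eq mult.commute)
    have sR: "s * (R (Suc t) - R t) \<le> w (Suc t)"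
    proof (cases "R (Suc t) = R t")
      case True
      then show ?thesis using w_nonneg by simp
    next
      case False
      then have "0 < R (Suc t) - R t" using Rm by simp
      then show ?thesis using elim(2) by (simp add: pos_less_divide_eq less_imp_le)
    qed
    have "V (Suc t) - V t = (excess_gain r (b (Suc t)) - b (Suc t) * w (Suc t))
        + m * (w (Suc t) - s * (R (Suc t) - R t)) + (D t + C) * (w t - w (Suc t))"
      unfolding V_def D_step P_step by (simp add: algebra_simps)
    moreover have "0 \<le> D t + C" using elim(4) P_nonneg[of t] by linarith
    ultimately show "V t \<le> V (Suc t)"
      using g sR w_anti m by (smt (verit) mult_nonneg_nonneg)
  qed
  then obtain N where N: "\<And>t. N \<le> t \<Longrightarrow> V t \<le> V (Suc t)"
    unfolding eventually_sequentially by blast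
  have V_low: "V N \<le> V t" if "N \<le> t" for t
    using that by (induction rule: dec_induct) (use N order_trans in blast)+
  have gap: "0 < m * s - p'" using s(1) m by (simp add: field_simps)
  show ?thesis
    using gain R_large[of 1] R_large[of "- V N / (m * s - p')"] eventually_ge_at_top[of N]
  proof eventually_elim
    case (elim t)
    have "0 \<le> w t"
      unfolding w_def using r \<beta> elim(2)
      by (intro divide_nonneg_nonneg excess_gain_nonneg) auto
    then have "0 \<le> (D t + C) * w t"
      using elim(1) P_nonneg[of t] by (intro mult_nonneg_nonneg) auto
    then have "m * s * R t + V N \<le> P t"
      using V_low[OF elim(4)] by (simp add: V_def)
    moreover have "- V N \<le> (m * s - p') * R t"
      using elim(3) gap by (simp add: field_simps)
    ultimately show ?case by (simp add: algebra_simps)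
  qed
qed

text \<open>
  Below the critical constant the bootstrap never stalls.  With \<open>\<beta> = c - p + \<eta>\<close> and \<open>p' = p + \<eta>\<close>, the
  product \<open>p' \<beta>\<close> has factors of sum \<open>c + 2 \<eta>\<close>, hence is at most \<open>(c + 2 \<eta>)\<^sup>2 / 4\<close>, whatever \<open>p\<close> is.
  So one small \<open>\<eta>\<close> serves all steps, and \<open>P \<ge> n \<eta> R\<close> eventually, for every \<open>n\<close>.
\<close>

lemma drift_constant_lower_bound:
  fixes b :: "nat \<Rightarrow> real" and r m :: real
  defines "P \<equiv> \<lambda>t. \<Sum>i=1..t. excess_gain r (b i)"
  defines "D \<equiv> \<lambda>t. \<Sum>i=1..t. b i - m"
  defines "R \<equiv> \<lambda>t::nat. sqrt_log_scale (real t)"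
  assumes r: "0 < r" and m: "0 < m" and b: "\<And>i. 0 \<le> b i"
    and drift: "eventually (\<lambda>t. D t \<le> c * R t) sequentially"
    and gain: "eventually (\<lambda>t. P t \<le> D t + C) sequentially"
  shows "2 * sqrt 2 * sqrt (m / ln 2) \<le> c"
proof (rule ccontr)
  assume "\<not> ?thesis"
  moreover define K where "K = 2 * sqrt 2 * sqrt (m / ln 2)"
  ultimately have "c < K" by simp
  have "K\<^sup>2 = 8 * m / ln 2"
    using m by (simp add: K_def power_mult_distrib)
  have P_nonneg: "0 \<le> P t" for t
    unfolding P_def using r b by (intro sum_nonneg excess_gain_nonneg) auto
  have R_large: "eventually (\<lambda>t. x \<le> R t) sequentially" for x
    using sqrt_log_scale_at_top unfolding R_def filterlim_at_top by blast
  have le_c: "p \<le> c" if "eventually (\<lambda>t. p * R t \<le> P t) sequentially" for p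
  proof (rule ccontr)
    assume "\<not> p \<le> c"
    then have "0 < p - c" by simp
    have "eventually (\<lambda>t. False) sequentially"
      using that drift gain R_large[of "(C + 1) / (p - c)"]
    proof eventually_elim
      case (elim t)
      have "C + 1 \<le> (p - c) * R t"
        using elim(4) \<open>0 < p - c\<close> by (simp add: field_simps)
      with elim show ?case by (simp add: algebra_simps)
    qed
    then show False by simp
  qed
  have "0 \<le> c" using le_c[of 0] P_nonneg by simp
  \<comment> \<open>The choice makes \<open>c + 2 \<eta>\<close> the midpoint of \<open>c\<close> and the critical value \<open>K\<close>.\<close>
  define \<eta> where "\<eta> = (K - c) / 4"
  have "0 < \<eta>" using \<open>c < K\<close> by (simp add: \<eta>_def)
  have "eventually (\<lambda>t. real n * \<eta> * R t \<le> P t) sequentially" for n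
  proof (induction n)
    case 0
    then show ?case using P_nonneg by simp
  next
    case (Suc n)
    let ?p = "real n * \<eta>"
    have "?p \<le> c" by (rule le_c[OF Suc.IH])
    have "4 * ((?p + \<eta>) * (c - ?p + \<eta>)) \<le> (c + 2 * \<eta>)\<^sup>2"
      using zero_le_power2[of "(?p + \<eta>) - (c - ?p + \<eta>)"] by (simp add: power2_eq_square algebra_simps)
    also have "\<dots> < K\<^sup>2"
      using \<open>0 \<le> c\<close> \<open>c < K\<close> by (intro power_strict_mono) (auto simp: \<eta>_def field_simps)
    finally have "(?p + \<eta>) * (c - ?p + \<eta>) < 2 * m / ln 2"
      using \<open>K\<^sup>2 = 8 * m / ln 2\<close> by simp
    then have "eventually (\<lambda>t. (?p + \<eta>) * R t \<le> P t) sequentially"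
      unfolding P_def R_def using r m b \<open>0 < \<eta>\<close> \<open>?p \<le> c\<close>
      by (intro gain_bound_bootstrap[OF _ _ _ drift[unfolded D_def R_def]
            gain[unfolded P_def D_def] Suc.IH[unfolded P_def R_def],
            where \<beta> = "c - ?p + \<eta>"]) auto
    then show ?case by (simp add: algebra_simps)
  qed
  then have "real n * \<eta> \<le> c" for n by (rule le_c)
  moreover obtain n where "c < real n * \<eta>"
    using reals_Archimedean3[OF \<open>0 < \<eta>\<close>] by blast
  ultimately show False by (meson not_le)
qed

theorem theorem1:
  fixes x :: real
  assumes "0 < x" and "x < 1" and "x \<notin> \<rat>"
    and "(minkowski_qm has_real_derivative 0) (at x)"
  shows "\<forall>\<epsilon>>0. infinite {t::nat. t \<ge> 1 \<and>
           phi1 x t \<ge> (2 * sqrt 2 - \<epsilon>) * kappa4 * sqrt (real t * ln (real t))}"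
proof (intro allI impI notI)
  fix \<epsilon> :: real
  let ?c = "(2 * sqrt 2 - \<epsilon>) * kappa4"
  let ?b = "\<lambda>i. real (cf_quot x i) - 1"
  assume \<epsilon>: "0 < \<epsilon>" and fin: "finite {t::nat. t \<ge> 1 \<and>
      phi1 x t \<ge> ?c * sqrt (real t * ln (real t))}"
  have x: "x \<in> {0<..<1}" "x \<notin> \<rat>" using assms by auto
  have phi1_eq: "(\<Sum>i=1..t. ?b i - (kappa1 - 1)) = phi1 x t" for t
    by (simp add: phi1_def cf_quot_sum_def sum_subtractf)
  obtain N where N: "\<And>t. N \<le> t \<Longrightarrow> 1 \<le> t \<Longrightarrow> phi1 x t < ?c * sqrt_log_scale (real t)"
  proof -
    obtain N where "\<forall>t \<in> {t. t \<ge> 1 \<and> phi1 x t \<ge> ?c * sqrt (real t * ln (real t))}. t < N"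
      using fin unfolding finite_nat_set_iff_bounded by blast
    then have "phi1 x t < ?c * sqrt_log_scale (real t)" if "N \<le> t" "1 \<le> t" for t
      unfolding sqrt_log_scale_def using that by fastforce
    then show ?thesis using that by blast
  qed
  have "2 * sqrt 2 * sqrt ((kappa1 - 1) / ln 2) \<le> ?c"
  proof (rule drift_constant_lower_bound[where b = ?b])
    show "0 < 1 / golden\<^sup>2" using golden_gt_1 by simp
    show "0 < kappa1 - 1" using kappa1_gt_1 by simp
    show "0 \<le> ?b i" for i using cf_quot_pos[OF x, of i] by simp
    show "eventually (\<lambda>t. (\<Sum>i=1..t. ?b i - (kappa1 - 1)) \<le> ?c * sqrt_log_scale (real t)) sequentially"
      unfolding phi1_eq using eventually_ge_at_top[of N] eventually_ge_at_top[of 1]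
      by eventually_elim (rule less_imp_le[OF N])
    show "eventually (\<lambda>t. (\<Sum>i=1..t. excess_gain (1 / golden\<^sup>2) (?b i))
        \<le> (\<Sum>i=1..t. ?b i - (kappa1 - 1)) + (kappa1 + 2)) sequentially"
      unfolding phi1_eq using continuant_square_le_of_deriv_0[OF x assms(4)]
      by eventually_elim (rule excess_gain_sum_le_phi1[OF x])
  qed
  then have "\<epsilon> * kappa4 \<le> 0"
    by (simp add: kappa4_def algebra_simps)
  moreover have "0 < kappa4" using kappa1_gt_1 by (simp add: kappa4_def)
  ultimately show False using \<epsilon> by (simp add: mult_le_0_iff)
qed

end
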